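(* Suppose $y\in \mathsf{Im}(A)$, $y\neq 0$, and let $x_s\in\mathcal{X}$ be the unique element with $A x_s = y$. For $\varepsilon>0$ and $M\in\{-1\}\cup\mathbb{N}$ let $X_\varepsilon^M$ be the $M$-th iterated quasi-reversibility solution with data $y$, and set $R_\varepsilon^M := X_\varepsilon^M - x_s$. Then for every $\varepsilon>0$, $R_\varepsilon^M \to 0$ strongly in $\mathcal{X}$ as $M\to\infty$; in other words, for any $\varepsilon>0$, $X_\varepsilon^M$ converges to $x_s$ in $\mathcal{X}$ as $M\to\infty$.
   Context: $\mathcal{X},\mathcal{Y}$ are real Hilbert spaces; $A:\mathcal{X}\to\mathcal{Y}$ is a continuous linear operator that is one-to-one, not onto, and has dense range in $\mathcal{Y}$. $b$ is a symmetric non-negative bilinear form on $\mathcal{X}$ with induced seminorm $\|x\|_b=\sqrt{b(x,x)}$, such that there are constants $c,C>0$ with $c^2\|x\|_\mathcal{X}^2\le \|Ax\|_\mathcal{Y}^2+\|x\|_b^2\le C^2\|x\|_\mathcal{X}^2$ for all $x\in\mathcal{X}$. $\mathbb{N}$ contains $0$. Iterated quasi-reversibility: for $\varepsilon>0$ and data $y\in\mathcal{Y}$, define $X_\varepsilon^{-1}=0$ and, for $M\in\mathbb{N}$, $X_\varepsilon^M$ is the unique element of $\mathcal{X}$ such that $$(AX_\varepsilon^M,Ax)_\mathcal{Y}+\varepsilon\, b(X_\varepsilon^M,x)=(y,Ax)_\mathcal{Y}+\varepsilon\, b(X_\varepsilon^{M-1},x)\quad\forall x\in\mathcal{X}.$$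 *)

theory Defs
  imports "HOL-Analysis.Analysis"
begin

definition bseminorm :: "('a \<Rightarrow> 'a \<Rightarrow> real) \<Rightarrow> 'a \<Rightarrow> real" where
  "bseminorm b x = sqrt (b x x)"

definition qr_step_solution ::
  "('a::real_inner \<Rightarrow> 'b::real_inner) \<Rightarrow> ('a \<Rightarrow> 'a \<Rightarrow> real) \<Rightarrow> real \<Rightarrow> 'b \<Rightarrow> 'a \<Rightarrow> 'a \<Rightarrow> bool" where
  "qr_step_solution A b \<epsilon> y z X \<longleftrightarrow>
     (\<forall>x. A X \<bullet> A x + \<epsilon> * b X x = y \<bullet> A x + \<epsilon> * b z x)"

(* The iterates are numbered from -1, so iqr_shift at n is the iterate of index n - 1.
   For \<epsilon> > 0 each description below denotes: the form (A u, A v) + \<epsilon> b(u, v) is bounded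
   and coercive under the two-sided estimate assumed of A and b. *)
primrec iqr_shift ::
  "('a::real_inner \<Rightarrow> 'b::real_inner) \<Rightarrow> ('a \<Rightarrow> 'a \<Rightarrow> real) \<Rightarrow> real \<Rightarrow> 'b \<Rightarrow> nat \<Rightarrow> 'a" where
  "iqr_shift A b \<epsilon> y 0 = 0"
| "iqr_shift A b \<epsilon> y (Suc n) = (THE X. qr_step_solution A b \<epsilon> y (iqr_shift A b \<epsilon> y n) X)"

(* Only indices M \<ge> -1 are meaningful. *)
definition iqr ::
  "('a::real_inner \<Rightarrow> 'b::real_inner) \<Rightarrow> ('a \<Rightarrow> 'a \<Rightarrow> real) \<Rightarrow> real \<Rightarrow> 'b \<Rightarrow> int \<Rightarrow> 'a" where
  "iqr A b \<epsilon> y M = iqr_shift A b \<epsilon> y (nat (M + 1))"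

end

theory Submission
  imports Defs
begin

text \<open>
  Write \<open>a u v = A u \<bullet> A v + \<epsilon> * b u v\<close>, an inner product equivalent to the given one. The errors
  satisfy \<open>a (R (n + 1)) v = \<epsilon> * b (R n) v\<close>, and by symmetry \<open>a (R i) (R j)\<close> depends on \<open>i + j\<close> only,
  say it equals \<open>s (i + j)\<close>. The sequence \<open>s\<close> is nonnegative and decreasing, hence convergent, and
  \<open>a (R m - R n) (R m - R n) = s (2m) - 2 s (m + n) + s (2n)\<close> shows that \<open>R\<close> is Cauchy. Since
  \<open>norm (A (R n)) ^ 2 = s (2n) - s (2n + 1)\<close> tends to \<open>0\<close> and \<open>A\<close> is injective, the limit is \<open>0\<close>.
\<close>

section \<open>Cauchy sequences, quadratic polynomials and symmetric forms\<close>

text \<open>Coercivity controls squared norms, so both completeness arguments below bound squares by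
  a null sequence.\<close>

lemma Cauchy_norm_diff_square:
  fixes x :: "nat \<Rightarrow> 'a::real_normed_vector"
  assumes bound: "\<And>N m n. N \<le> m \<Longrightarrow> N \<le> n \<Longrightarrow> (norm (x m - x n))\<^sup>2 \<le> e N"
    and e: "e \<longlonglongrightarrow> 0"
  shows "Cauchy x"
proof (rule CauchyI)
  fix r :: real assume r: "0 < r"
  have "eventually (\<lambda>N. e N < r\<^sup>2) sequentially"
    using order_tendstoD(2)[OF e] r by simp
  then obtain N where N: "e N < r\<^sup>2"
    by (auto simp: eventually_sequentially)
  have "norm (x m - x n) < r" if "m \<ge> N" "n \<ge> N" for m n
  proof (rule power2_less_imp_less)
    show "(norm (x m - x n))\<^sup>2 < r\<^sup>2" using bound[OF that] N by simp
  qed (use r in simp)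
  then show "\<exists>M. \<forall>m\<ge>M. \<forall>n\<ge>M. norm (x m - x n) < r" by blast
qed

lemma bilinear_symmetric_add_square:
  assumes "bilinear a" and "\<And>u v. a u v = a v u"
  shows "a (u + t *\<^sub>R v) (u + t *\<^sub>R v) = a u u + 2 * t * a u v + t\<^sup>2 * (a v v :: real)"
  using assms(2)[of v u]
  by (simp add: bilinear_ladd[OF assms(1)] bilinear_radd[OF assms(1)] bilinear_lmul[OF assms(1)]
      bilinear_rmul[OF assms(1)] power2_eq_square algebra_simps)

text \<open>Near \<open>0\<close> the linear term dominates. This serves as the first-order
  condition at a minimiser.\<close>

lemma linear_coeff_zero_if_quadratic_nonneg:
  fixes p q :: real
  assumes "\<And>t. 0 \<le> 2 * t * p + t\<^sup>2 * q"
  shows "p = 0"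
proof -
  \<comment> \<open>The polynomial at \<open>- p / d\<close> equals
    \<open>- p^2 * (2 * d - q) / d^2\<close>; the summand \<open>1\<close> keeps \<open>d\<close>
    positive when \<open>q = 0\<close>.\<close>
  define d where "d = \<bar>q\<bar> + 1"
  have d: "d > 0" "q \<le> d - 1" by (auto simp: d_def)
  have "0 \<le> 2 * (- p / d) * p + (- p / d)\<^sup>2 * q" by (rule assms)
  also have "\<dots> \<le> 2 * (- p / d) * p + (- p / d)\<^sup>2 * (d - 1)"
    using d by (intro add_left_mono mult_left_mono) auto
  also have "\<dots> = - (p\<^sup>2 * (d + 1) / d\<^sup>2)"
    using d by (simp add: field_simps power2_eq_square)
  finally have "p\<^sup>2 * (d + 1) / d\<^sup>2 \<le> 0" by simp
  then have "p\<^sup>2 * (d + 1) \<le> 0" using d by (simp add: divide_le_0_iff)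
  then show "p = 0" using d by (simp add: mult_le_0_iff)
qed

text \<open>The quadratic polynomial \<open>t\<close> maps to \<open>a (u + t v) (u + t v)\<close>
  is nonnegative. As \<open>a\<close> may be degenerate, the case of a vanishing leading coefficient
  is separate.\<close>

lemma bilinear_symmetric_Cauchy_Schwarz:
  fixes a :: "'a::real_vector \<Rightarrow> 'a \<Rightarrow> real"
  assumes bil: "bilinear a" and sym: "\<And>u v. a u v = a v u" and pos: "\<And>u. 0 \<le> a u u"
  shows "(a u v)\<^sup>2 \<le> a u u * a v v"
proof (cases "a v v = 0")
  case True
  have "a u v = 0"
  proof (rule ccontr)
    assume nz: "a u v \<noteq> 0"
    \<comment> \<open>With \<open>a v v = 0\<close> the polynomial is affine, and this
      \<open>t\<close> gives it the value \<open>-1\<close>.\<close>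
    define t where "t = - (a u u + 1) / (2 * a u v)"
    have "0 \<le> a (u + t *\<^sub>R v) (u + t *\<^sub>R v)" by (rule pos)
    moreover have "2 * t * a u v = - (a u u + 1)" using nz by (simp add: t_def)
    ultimately show False
      unfolding bilinear_symmetric_add_square[OF bil sym] using True by simp
  qed
  then show ?thesis using True by simp
next
  case False
  then have v: "a v v > 0" using pos[of v] by simp
  \<comment> \<open>The chosen factor of \<open>v\<close> minimises the polynomial.\<close>
  have "0 \<le> a (u + (- (a u v / a v v)) *\<^sub>R v) (u + (- (a u v / a v v)) *\<^sub>R v)" by (rule pos)
  then have "0 \<le> a u u - (a u v)\<^sup>2 / a v v"
    unfolding bilinear_symmetric_add_square[OF bil sym]
    using v by (simp add: power2_eq_square)
  then show ?thesis using v by (simp add: field_simps)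
qed

text \<open>Cauchy-Schwarz carries the bound from the diagonal to all pairs. In the theorem this
  extracts the continuity of \<open>b\<close> from the upper estimate.\<close>

lemma bounded_bilinear_if_diagonal_bounded:
  fixes a :: "'a::real_normed_vector \<Rightarrow> 'a \<Rightarrow> real"
  assumes bil: "bilinear a" and sym: "\<And>u v. a u v = a v u" and pos: "\<And>u. 0 \<le> a u u"
    and bound: "\<And>u. a u u \<le> K\<^sup>2 * (norm u)\<^sup>2"
  shows "bounded_bilinear a"
proof
  show "\<exists>K. \<forall>u v. norm (a u v) \<le> norm u * norm v * K"
  proof (intro exI allI)
    fix u v
    have "(a u v)\<^sup>2 \<le> a u u * a v v"
      by (rule bilinear_symmetric_Cauchy_Schwarz[OF bil sym pos])
    also have "\<dots> \<le> (K\<^sup>2 * (norm u)\<^sup>2) * (K\<^sup>2 * (norm v)\<^sup>2)"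
      by (intro mult_mono bound pos) simp
    also have "\<dots> = (norm u * norm v * K\<^sup>2)\<^sup>2"
      by (simp add: power_mult_distrib power2_eq_square)
    finally show "norm (a u v) \<le> norm u * norm v * K\<^sup>2"
      using abs_le_square_iff[of "a u v" "norm u * norm v * K\<^sup>2"] by simp
  qed
qed (simp_all add: bilinear_ladd[OF bil] bilinear_radd[OF bil] bilinear_lmul[OF bil]
    bilinear_rmul[OF bil])

lemma bounded_bilinear_add:
  assumes "bounded_bilinear f" and "bounded_bilinear g"
  shows "bounded_bilinear (\<lambda>u v. f u v + g u v)"
proof -
  interpret f: bounded_bilinear f by (rule assms)
  interpret g: bounded_bilinear g by (rule assms)
  show ?thesis
  proof
    obtain K L where "\<And>u v. norm (f u v) \<le> norm u * norm v * K"
      "\<And>u v. norm (g u v) \<le> norm u * norm v * L"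
      using f.bounded g.bounded by blast
    then have "norm (f u v + g u v) \<le> norm u * norm v * (K + L)" for u v
      unfolding distrib_left by (intro norm_triangle_mono)
    then show "\<exists>K. \<forall>u v. norm (f u v + g u v) \<le> norm u * norm v * K" by blast
  qed (simp_all add: f.add_left f.add_right g.add_left g.add_right f.scaleR_left f.scaleR_right
      g.scaleR_left g.scaleR_right scaleR_add_right)
qed

section \<open>Unique solvability for coercive symmetric forms\<close>

text \<open>
  The solution is the minimiser of \<open>Q v = a v v - 2 * f v\<close>; minimising sequences are Cauchy by the
  parallelogram law.
\<close>

lemma coercive_symmetric_form_represents:
  fixes a :: "'a::{real_normed_vector, complete_space} \<Rightarrow> 'a \<Rightarrow> real"
  assumes bnd: "bounded_bilinear a" and sym: "\<And>u v. a u v = a v u"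
    and \<alpha>: "0 < \<alpha>" and coercive: "\<And>u. \<alpha> * (norm u)\<^sup>2 \<le> a u u"
    and f: "bounded_linear f"
  shows "\<exists>!u. \<forall>v. a u v = f v"
proof -
  interpret a: bounded_bilinear a by (rule bnd)
  interpret f: bounded_linear f by (rule f)
  have bil: "bilinear a"
    using a.bounded_linear_left a.bounded_linear_right bounded_linear.linear
    unfolding bilinear_def by blast
  define Q where "Q v = a v v - 2 * f v" for v
  obtain K where K: "\<And>v. norm (f v) \<le> norm v * K" using f.bounded by blast
  have Q_lower: "- (K\<^sup>2 / \<alpha>) \<le> Q v" for v
  proof -
    \<comment> \<open>Completing the square in \<open>norm v\<close> bounds \<open>Q\<close> from
      below.\<close>
    have "0 \<le> (\<alpha> * norm v - K)\<^sup>2 / \<alpha>" using \<alpha> by simp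
    also have "\<dots> = \<alpha> * (norm v)\<^sup>2 - 2 * (norm v * K) + K\<^sup>2 / \<alpha>"
      using \<alpha> by (simp add: field_simps power2_eq_square)
    also have "\<dots> \<le> Q v + K\<^sup>2 / \<alpha>"
      unfolding Q_def using coercive[of v] K[of v] by simp
    finally show ?thesis by simp
  qed
  define m where "m = (INF v. Q v)"
  have bdd: "bdd_below (range Q)" using Q_lower by (intro bdd_belowI2)
  have m_le: "m \<le> Q v" for v unfolding m_def by (rule cINF_lower[OF bdd]) simp
  have "\<exists>v. Q v < m + inverse (real (Suc n))" for n
    using cInf_lessD[of "range Q" "m + inverse (real (Suc n))"] unfolding m_def by auto
  then obtain w where w: "\<And>n. Q (w n) < m + inverse (real (Suc n))" by metis
  have mid: "a (u - v) (u - v) = 2 * Q u + 2 * Q v - 4 * Q ((1/2) *\<^sub>R (u + v))" for u v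
    unfolding Q_def
    by (simp add: a.add_left a.add_right a.diff_left a.diff_right a.scaleR_left a.scaleR_right
        f.add f.scaleR sym[of v u] algebra_simps)
  have "Cauchy w"
  proof (rule Cauchy_norm_diff_square)
    fix N i j :: nat assume "N \<le> i" "N \<le> j"
    then have "inverse (real (Suc i)) \<le> inverse (real (Suc N))"
      "inverse (real (Suc j)) \<le> inverse (real (Suc N))" by simp_all
    \<comment> \<open>The midpoint has \<open>Q\<close> at least \<open>m\<close>, so in
      \<open>mid\<close> the multiples of \<open>m\<close> cancel and only the excesses over
      \<open>m\<close> remain.\<close>
    then have "a (w i - w j) (w i - w j) \<le> 4 * inverse (real (Suc N))"
      unfolding mid using w[of i] w[of j] m_le[of "(1/2) *\<^sub>R (w i + w j)"] by linarith
    with coercive[of "w i - w j"]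
    have "\<alpha> * (norm (w i - w j))\<^sup>2 \<le> 4 * inverse (real (Suc N))" by (rule order_trans)
    then show "(norm (w i - w j))\<^sup>2 \<le> 4 / \<alpha> * inverse (real (Suc N))"
      using \<alpha> by (simp add: pos_le_divide_eq mult.commute)
  next
    show "(\<lambda>N. 4 / \<alpha> * inverse (real (Suc N))) \<longlonglongrightarrow> 0"
      by (rule tendsto_mult_right_zero[OF LIMSEQ_inverse_real_of_nat])
  qed
  then obtain u where u: "w \<longlonglongrightarrow> u"
    using Cauchy_convergent convergent_def by blast
  have "(\<lambda>n. Q (w n)) \<longlonglongrightarrow> Q u"
    unfolding Q_def by (intro tendsto_intros a.tendsto f.tendsto u)
  moreover have "(\<lambda>n. m + inverse (real (Suc n))) \<longlonglongrightarrow> m + 0"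
    by (intro tendsto_intros LIMSEQ_inverse_real_of_nat)
  ultimately have "Q u \<le> m + 0"
    by (rule LIMSEQ_le) (use w less_imp_le in blast)
  then have min: "Q u \<le> Q v" for v using m_le[of v] by simp
  have sol: "a u v = f v" for v
  proof -
    have "a u v - f v = 0"
    proof (rule linear_coeff_zero_if_quadratic_nonneg)
      fix t
      \<comment> \<open>This polynomial is the increment of \<open>Q\<close> from \<open>u\<close>
        to \<open>u + t v\<close>.\<close>
      show "0 \<le> 2 * t * (a u v - f v) + t\<^sup>2 * a v v"
        using min[of "u + t *\<^sub>R v"] unfolding Q_def bilinear_symmetric_add_square[OF bil sym]
        by (simp add: f.add f.scaleR algebra_simps)
    qed
    then show ?thesis by simp
  qed
  have "u' = u" if "\<forall>v. a u' v = f v" for u'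
  proof -
    have "a (u' - u) (u' - u) = 0" using that sol by (simp add: a.diff_left)
    then have "\<alpha> * (norm (u' - u))\<^sup>2 \<le> 0" using coercive[of "u' - u"] by simp
    then show ?thesis using \<alpha> by (simp add: mult_le_0_iff)
  qed
  with sol show ?thesis by blast
qed

section \<open>Convergence of the error iteration\<close>

text \<open>The parameter is absorbed: \<open>b\<close> here stands for
  \<open>\<epsilon> * b\<close> in the theorem. Coercivity of the sum yields a strong limit, and
  definiteness of \<open>p\<close> alone identifies it as \<open>0\<close>.\<close>

lemma iterated_form_tendsto_zero:
  fixes p b :: "'a::{real_normed_vector, complete_space} \<Rightarrow> 'a \<Rightarrow> real" and R :: "nat \<Rightarrow> 'a"
  assumes p: "bounded_bilinear p" and b: "bounded_bilinear b"
    and p_sym: "\<And>u v. p u v = p v u" and b_sym: "\<And>u v. b u v = b v u"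
    and p_pos: "\<And>u. u \<noteq> 0 \<Longrightarrow> 0 < p u u" and b_nonneg: "\<And>u. 0 \<le> b u u"
    and \<alpha>: "0 < \<alpha>" and coercive: "\<And>u. \<alpha> * (norm u)\<^sup>2 \<le> p u u + b u u"
    and step: "\<And>n v. p (R (Suc n)) v + b (R (Suc n)) v = b (R n) v"
  shows "R \<longlonglongrightarrow> 0"
proof -
  interpret p: bounded_bilinear p by (rule p)
  interpret b: bounded_bilinear b by (rule b)
  have p_nonneg: "0 \<le> p u u" for u
    using p_pos[of u] by (cases "u = 0") (auto simp: p.zero_left)
  define a where "a u v = p u v + b u v" for u v
  have a_sym: "a u v = a v u" for u v unfolding a_def using p_sym b_sym by simp
  have a_step: "a (R (Suc n)) v = b (R n) v" for n v using step by (simp add: a_def)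
  define s where "s n = a (R n) (R 0)" for n
  have a_s: "a (R i) (R j) = s (i + j)" for i j
  proof (induction j arbitrary: i)
    case (Suc j)
    \<comment> \<open>By symmetry both sides equal \<open>b (R i) (R j)\<close>, so a step moves
      from one argument to the other.\<close>
    have "a (R i) (R (Suc j)) = a (R (Suc i)) (R j)"
      using a_step[of j "R i"] a_step[of i "R j"] a_sym[of "R i" "R (Suc j)"] b_sym by simp
    then show ?case using Suc[of "Suc i"] by simp
  qed (simp add: s_def)
  have s_even: "s (2 * k) = p (R k) (R k) + b (R k) (R k)" for k
    using a_s[of k k] by (simp add: a_def mult_2)
  have s_odd: "s (Suc (2 * k)) = b (R k) (R k)" for k
    using a_s[of "Suc k" k] a_step[of k "R k"] by (simp add: mult_2)
  have even_step: "s (Suc (2 * k)) \<le> s (2 * k)" for k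
    using s_even s_odd p_nonneg by simp
  have odd_step: "s (Suc (Suc (2 * k))) \<le> s (Suc (2 * k))" for k
  proof -
    \<comment> \<open>In the expansion the cross term is \<open>s (2k + 2)\<close>, counted twice;
      one copy absorbs the diagonal term at \<open>Suc k\<close>.\<close>
    have "0 \<le> b (R k - R (Suc k)) (R k - R (Suc k))" by (rule b_nonneg)
    also have "\<dots> = b (R k) (R k) + b (R (Suc k)) (R (Suc k)) - 2 * b (R k) (R (Suc k))"
      using b_sym[of "R (Suc k)" "R k"] by (simp add: b.diff_left b.diff_right)
    also have "b (R k) (R (Suc k)) = s (Suc (Suc (2 * k)))"
      using a_step[of k "R (Suc k)"] a_s[of "Suc k" "Suc k"] by (simp add: mult_2)
    also have "b (R (Suc k)) (R (Suc k)) \<le> s (Suc (Suc (2 * k)))"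
      using s_even[of "Suc k"] p_nonneg[of "R (Suc k)"] by simp
    finally show ?thesis using s_odd[of k] by simp
  qed
  have "s (Suc n) \<le> s n" for n
    using even_step[of "n div 2"] odd_step[of "n div 2"]
    by (cases "even n") (auto elim!: evenE oddE)
  then have dec: "decseq s" by (rule decseq_SucI)
  have "0 \<le> s n" for n
    using s_even[of "n div 2"] s_odd[of "n div 2"] p_nonneg[of "R (n div 2)"]
      b_nonneg[of "R (n div 2)"]
    by (cases "even n") (auto elim!: evenE oddE)
  then obtain L where L: "s \<longlonglongrightarrow> L" and L_le: "\<And>n. L \<le> s n"
    using decseq_convergent[OF dec] by blast
  have "Cauchy R"
  proof (rule Cauchy_norm_diff_square)
    fix N m n :: nat assume mn: "N \<le> m" "N \<le> n"
    have "\<alpha> * (norm (R m - R n))\<^sup>2 \<le> a (R m - R n) (R m - R n)"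
      unfolding a_def by (rule coercive)
    also have "\<dots> = a (R m) (R m) - a (R m) (R n) - a (R n) (R m) + a (R n) (R n)"
      by (simp add: a_def p.diff_left p.diff_right b.diff_left b.diff_right)
    also have "\<dots> = s (m + m) + s (n + n) - 2 * s (m + n)"
      by (simp add: a_s add.commute)
    \<comment> \<open>Both \<open>2m\<close> and \<open>2n\<close> are at least \<open>N\<close>,
      and the cross term is at least the limit \<open>L\<close>.\<close>
    also have "\<dots> \<le> 2 * (s N - L)"
      using decseqD[OF dec, of N "m + m"] decseqD[OF dec, of N "n + n"] L_le[of "m + n"] mn
      by simp
    finally show "(norm (R m - R n))\<^sup>2 \<le> 2 / \<alpha> * (s N - L)"
      using \<alpha> by (simp add: field_simps)
  next
    have "(\<lambda>N. s N - L) \<longlonglongrightarrow> 0" using L by (simp add: LIM_zero)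
    then show "(\<lambda>N. 2 / \<alpha> * (s N - L)) \<longlonglongrightarrow> 0" by (rule tendsto_mult_right_zero)
  qed
  then obtain r where r: "R \<longlonglongrightarrow> r"
    using Cauchy_convergent convergent_def by blast
  have "(\<lambda>k. s (2 * k)) \<longlonglongrightarrow> L" "(\<lambda>k. s (Suc (2 * k))) \<longlonglongrightarrow> L"
    using LIMSEQ_subseq_LIMSEQ[OF L, of "\<lambda>k. 2 * k"]
      LIMSEQ_subseq_LIMSEQ[OF L, of "\<lambda>k. Suc (2 * k)"]
    by (auto simp: strict_mono_def o_def)
  then have "(\<lambda>k. s (2 * k) - s (Suc (2 * k))) \<longlonglongrightarrow> L - L" by (rule tendsto_diff)
  then have "(\<lambda>k. p (R k) (R k)) \<longlonglongrightarrow> 0" by (simp add: s_even s_odd)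
  moreover have "(\<lambda>k. p (R k) (R k)) \<longlonglongrightarrow> p r r" by (intro p.tendsto r)
  ultimately have "p r r = 0" using LIMSEQ_unique by blast
  then have "r = 0" using p_pos[of r] by fastforce
  with r show ?thesis by simp
qed

section \<open>Application to iterated quasi-reversibility\<close>

theorem theorem4p2:
  fixes A :: "'a::{real_inner, complete_space} \<Rightarrow> 'b::{real_inner, complete_space}"
    and b :: "'a \<Rightarrow> 'a \<Rightarrow> real"
    and c C :: real
    and y :: 'b
    and x\<^sub>s :: 'a
  assumes A_continuous_linear: "bounded_linear A"
    and A_one_to_one: "inj A"
    and A_not_onto: "\<not> surj A"
    and A_dense_range: "closure (range A) = UNIV"
    and b_bilinear: "bilinear b"
    and b_symmetric: "\<And>u v. b u v = b v u"
    and b_nonneg: "\<And>u. 0 \<le> b u u"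
    and c_pos: "0 < c"
    and C_pos: "0 < C"
    and lower_bound: "\<And>x. c\<^sup>2 * (norm x)\<^sup>2 \<le> (norm (A x))\<^sup>2 + (bseminorm b x)\<^sup>2"
    and upper_bound: "\<And>x. (norm (A x))\<^sup>2 + (bseminorm b x)\<^sup>2 \<le> C\<^sup>2 * (norm x)\<^sup>2"
    and y_in_range: "y \<in> range A"
    and y_nonzero: "y \<noteq> 0"
    and x\<^sub>s_solution: "A x\<^sub>s = y"
  shows "\<forall>\<epsilon>>0. ((\<lambda>M::nat. iqr A b \<epsilon> y (int M) - x\<^sub>s) \<longlonglongrightarrow> 0)
               \<and> ((\<lambda>M::nat. iqr A b \<epsilon> y (int M)) \<longlonglongrightarrow> x\<^sub>s)"
proof (intro allI impI)
  fix \<epsilon> :: real assume \<epsilon>: "0 < \<epsilon>"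
  interpret A: bounded_linear A by (rule A_continuous_linear)
  define p where "p u v = A u \<bullet> A v" for u v
  have b_diag: "(bseminorm b u)\<^sup>2 = b u u" for u
    using b_nonneg by (simp add: bseminorm_def)
  have p_bounded: "bounded_bilinear p"
    unfolding p_def
    by (rule bounded_bilinear.comp[OF bounded_bilinear_inner A_continuous_linear
          A_continuous_linear])
  have "b u u \<le> C\<^sup>2 * (norm u)\<^sup>2" for u
    using upper_bound[of u] zero_le_power2[of "norm (A u)"] unfolding b_diag by linarith
  then have "bounded_bilinear b"
    by (rule bounded_bilinear_if_diagonal_bounded[OF b_bilinear b_symmetric b_nonneg])
  then interpret b: bounded_bilinear b .
  have B_bounded: "bounded_bilinear (\<lambda>u v. \<epsilon> * b u v)"
    using b.comp[OF bounded_linear_scaleR_right[of \<epsilon>] bounded_linear_ident]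
    by (simp add: b.scaleR_left)
  have a_bounded: "bounded_bilinear (\<lambda>u v. p u v + \<epsilon> * b u v)"
    by (rule bounded_bilinear_add[OF p_bounded B_bounded])
  \<comment> \<open>The factor \<open>min 1 \<epsilon>\<close> is below both weights,
    \<open>1\<close> of \<open>p\<close> and \<open>\<epsilon>\<close> of \<open>b\<close>;
    \<open>c^2\<close> comes from the lower estimate.\<close>
  define \<alpha> where "\<alpha> = min 1 \<epsilon> * c\<^sup>2"
  have \<alpha>: "0 < \<alpha>" using \<epsilon> c_pos by (simp add: \<alpha>_def)
  have coercive: "\<alpha> * (norm u)\<^sup>2 \<le> p u u + \<epsilon> * b u u" for u
  proof -
    have "\<alpha> * (norm u)\<^sup>2 \<le> min 1 \<epsilon> * (p u u + b u u)"
      unfolding \<alpha>_def mult.assoc using lower_bound[of u] \<epsilon>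
      by (intro mult_left_mono) (auto simp: b_diag p_def power2_norm_eq_inner)
    also have "\<dots> = min 1 \<epsilon> * p u u + min 1 \<epsilon> * b u u" by (rule distrib_left)
    also have "\<dots> \<le> 1 * p u u + \<epsilon> * b u u"
      by (intro add_mono mult_right_mono b_nonneg) (auto simp: p_def)
    finally show ?thesis by simp
  qed
  define X where "X = iqr_shift A b \<epsilon> y"
  \<comment> \<open>The iterates are \<open>THE\<close> descriptions, so their equation has to be
    drawn from unique solvability.\<close>
  have X_step: "qr_step_solution A b \<epsilon> y (X n) (X (Suc n))" for n
  proof -
    have "bounded_linear (\<lambda>v. y \<bullet> A v + \<epsilon> * b (X n) v)"
      by (intro bounded_linear_add bounded_linear_inner_right_comp bounded_linear_const_mult
          A_continuous_linear b.bounded_linear_right)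
    then have "\<exists>!Z. \<forall>v. p Z v + \<epsilon> * b Z v = y \<bullet> A v + \<epsilon> * b (X n) v"
      by (intro coercive_symmetric_form_represents[OF a_bounded _ \<alpha> coercive])
        (auto simp: p_def inner_commute b_symmetric)
    then have "\<exists>!Z. qr_step_solution A b \<epsilon> y (X n) Z"
      by (simp add: qr_step_solution_def p_def)
    then show ?thesis unfolding X_def iqr_shift.simps by (rule theI')
  qed
  have "(\<lambda>n. X n - x\<^sub>s) \<longlonglongrightarrow> 0"
  proof (rule iterated_form_tendsto_zero[OF p_bounded B_bounded _ _ _ _ \<alpha> coercive])
    show "0 < p u u" if "u \<noteq> 0" for u
      using injD[OF A_one_to_one, of u 0] that by (auto simp: p_def A.zero)
    \<comment> \<open>Since \<open>A x\<^sub>s = y\<close>, the exact solution is a fixed point of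
      the iteration; subtracting its equation removes the data term.\<close>
    show "p (X (Suc n) - x\<^sub>s) v + \<epsilon> * b (X (Suc n) - x\<^sub>s) v = \<epsilon> * b (X n - x\<^sub>s) v" for n v
      using X_step[of n] x\<^sub>s_solution
      by (simp add: qr_step_solution_def p_def A.diff b.diff_left inner_diff_left algebra_simps)
  qed (use \<epsilon> b_nonneg in \<open>auto simp: p_def inner_commute b_symmetric\<close>)
  \<comment> \<open>\<open>X 0\<close> is the iterate of index \<open>-1\<close>, so index
    \<open>M\<close> corresponds to \<open>X (Suc M)\<close>.\<close>
  then have "(\<lambda>n. X (Suc n) - x\<^sub>s) \<longlonglongrightarrow> 0" by (rule LIMSEQ_Suc)
  moreover have "iqr A b \<epsilon> y (int M) = X (Suc M)" for M
    unfolding iqr_def X_def by (simp only: int_Suc[symmetric] nat_int)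
  ultimately show "((\<lambda>M::nat. iqr A b \<epsilon> y (int M) - x\<^sub>s) \<longlonglongrightarrow> 0)
      \<and> ((\<lambda>M::nat. iqr A b \<epsilon> y (int M)) \<longlonglongrightarrow> x\<^sub>s)"
    by (simp add: LIM_zero_iff)
qed

end
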